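(* Let $f\ge k_{\rm tt}/k_{\rm nt}$ (with $k_{\rm nt}>0$) and $\mathbf u_0=\mathbf 0$. Pick an arbitrary $R>0$ and define the piecewise affine Lipschitz-continuous external force $\mathbf F:[0,2]\to\mathbb R^2$ by $$\mathbf F(s)=\begin{cases}(sR/f,\ sR)&\text{if }s\in[0,1],\\ \bigl(R/f+(s-1),\ R+(f+1)(s-1)\bigr)&\text{if }s\in[1,2].\end{cases}$$ Then the functions $\mathbf u,\mathbf t\in BV^+([0,2];\mathbb R^2)$ defined by $\mathbf u(s)=\mathbf 0$, $\mathbf t(s)=-\mathbf F(s)=-(sR/f,\ sR)$ if $s\in[0,1[$, and, if $s\in[1,2]$, $\mathbf t(s)=\mathbf 0$ and $$\mathbf u(s)=\left(\frac{R(k_{\rm tt}/f-k_{\rm nt})+[k_{\rm tt}-k_{\rm nt}(f+1)](s-1)}{k_{\rm nn}k_{\rm tt}-k_{\rm nt}^2},\ \frac{R(k_{\rm nn}-k_{\rm nt}/f)+[k_{\rm nn}(f+1)-k_{\rm nt}](s-1)}{k_{\rm nn}k_{\rm tt}-k_{\rm nt}^2}\right)$$ (whose first component is $\le0$), are a solution of the discrete quasi-static problem on $[0,2]$ with external force $\mathbf F$ and initial condition $\mathbf u_0$, with a jump at $s=1$.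
   Context: Vectors of $\mathbb R^2$ are written $(x_{\rm n},x_{\rm t})$. $\mathbf K=\begin{pmatrix}k_{\rm nn}&k_{\rm nt}\\k_{\rm nt}&k_{\rm tt}\end{pmatrix}$ is a positive definite symmetric matrix with $k_{\rm nt}\ge0$, and $f\ge0$ is the friction coefficient. $BV^+([0,S];\mathbb R^2)$ is the space of right-continuous functions of bounded variation on $[0,S]$ (conventions $\mathbf u(0-)=\mathbf u(0)$, $\mathbf u(S+)=\mathbf u(S)$); for $u$ in it, $\dot u$ is the Stieltjes measure, $\dot u([s_1,s_2])=u(s_2+)-u(s_1-)$. $\mathbf u_0\in\mathbb R^2$ is admissible with respect to $\mathbf F\in\mathbb R^2$ if there is $\mathbf t\in\mathbb R^2$ with $\mathbf K\mathbf u_0=\mathbf F+\mathbf t$, $u_{0\rm n}\le0$, $t_{\rm n}\le0$, $u_{0\rm n}t_{\rm n}=0$, $|t_{\rm t}|\le-ft_{\rm n}$. Discrete quasi-static problem: given $\mathbf F\in BV^+([0,S];\mathbb R^2)$ and $\mathbf u_0$ admissible with respect to $\mathbf F(0)$, $\mathbf u,\mathbf t\in BV^+([0,S];\mathbb R^2)$ is a solution if $\mathbf u(0)=\mathbf u_0$ and, for all $s\in[0,S]$: $\mathbf K\mathbf u(s)=\mathbf F(s)+\mathbf t(s)$; $u_{\rm n}(s)\le0$, $t_{\rm n}(s)\le0$, $u_{\rm n}(s)t_{\rm n}(s)=0$; $|t_{\rm t}(s)|\le-ft_{\rm n}(s)$; and, as measures on $[0,S]$, $t_{\rm t}\dot u_{\rm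 t}=ft_{\rm n}|\dot u_{\rm t}|$, where $|\dot u_{\rm t}|$ is the total variation measure of $\dot u_{\rm t}$. *)

theory Defs
  imports "HOL-Analysis.Analysis"
begin

text \<open>A vector of the plane is an element \<open>x\<close> of \<^typ>\<open>real^2\<close>, with normal component \<open>x $ 1\<close> and
  tangential component \<open>x $ 2\<close>.  Functions on the interval from \<open>0\<close> to \<open>S\<close> are total functions on
  \<^typ>\<open>real\<close> whose values outside the interval play no role.\<close>

subsection \<open>Functions of bounded variation\<close>

definition bounded_variation_on :: "real \<Rightarrow> real \<Rightarrow> (real \<Rightarrow> 'a::metric_space) \<Rightarrow> bool" where
  "bounded_variation_on a b u \<longleftrightarrow>
     (\<exists>B. \<forall>(n::nat) p. (\<forall>i\<le>n. p i \<in> {a..b}) \<and> (\<forall>i<n. p i \<le> p (Suc i)) \<longrightarrow>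
        (\<Sum>i<n. dist (u (p i)) (u (p (Suc i)))) \<le> B)"

definition BV_plus :: "real \<Rightarrow> (real \<Rightarrow> 'a::metric_space) set" where
  "BV_plus S = {u. bounded_variation_on 0 S u \<and> (\<forall>s\<in>{0..<S}. continuous (at_right s) u)}"

text \<open>One-sided limits on the interval from \<open>0\<close> to \<open>S\<close>, with the conventions \<open>u(0-) = u(0)\<close> and
  \<open>u(S+) = u(S)\<close>.\<close>

definition left_limit :: "(real \<Rightarrow> 'a::t2_space) \<Rightarrow> real \<Rightarrow> 'a" where
  "left_limit u s = (if s = 0 then u 0 else Lim (at_left s) u)"

definition right_limit :: "real \<Rightarrow> (real \<Rightarrow> 'a::t2_space) \<Rightarrow> real \<Rightarrow> 'a" where
  "right_limit S u s = (if s = S then u S else Lim (at_right s) u)"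

definition has_jump_at :: "(real \<Rightarrow> 'a::t2_space) \<Rightarrow> real \<Rightarrow> bool" where
  "has_jump_at u s \<longleftrightarrow> (\<exists>l r. (u \<longlongrightarrow> l) (at_left s) \<and> (u \<longlongrightarrow> r) (at_right s) \<and> l \<noteq> r)"

subsection \<open>Finite signed measures\<close>

text \<open>The measure \<open>M\<close> only supplies the underlying measurable space; it is that of the Borel
  subsets of an interval in all uses below.\<close>

definition signed_measure :: "'a measure \<Rightarrow> ('a set \<Rightarrow> real) \<Rightarrow> bool" where
  "signed_measure M \<mu> \<longleftrightarrow> \<mu> {} = 0 \<and>
     (\<forall>A::nat \<Rightarrow> 'a set. range A \<subseteq> sets M \<longrightarrow> disjoint_family A \<longrightarrow> (\<lambda>i. \<mu> (A i)) sums \<mu> (\<Union>i. A i))"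

definition total_variation_measure :: "'a measure \<Rightarrow> ('a set \<Rightarrow> real) \<Rightarrow> 'a measure" where
  "total_variation_measure M \<mu> = measure_of (space M) (sets M)
     (\<lambda>A. SUP P\<in>{P. finite P \<and> P \<subseteq> sets M \<and> disjoint P \<and> \<Union>P = A}. \<Sum>B\<in>P. ennreal \<bar>\<mu> B\<bar>)"

text \<open>The positive part of the Jordan decomposition; the negative part of \<open>\<mu>\<close> is the positive
  part of \<open>- \<mu>\<close>.  Negative values of \<open>\<mu> B\<close> are truncated to \<open>0\<close> by \<^const>\<open>ennreal\<close>, which
  does not affect the supremum since \<open>B = {}\<close> is allowed.\<close>

definition positive_part_measure :: "'a measure \<Rightarrow> ('a set \<Rightarrow> real) \<Rightarrow> 'a measure" where
  "positive_part_measure M \<mu> = measure_of (space M) (sets M)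
     (\<lambda>A. SUP B\<in>{B \<in> sets M. B \<subseteq> A}. ennreal (\<mu> B))"

definition signed_set_integral ::
    "'a measure \<Rightarrow> ('a set \<Rightarrow> real) \<Rightarrow> 'a set \<Rightarrow> ('a \<Rightarrow> real) \<Rightarrow> real" where
  "signed_set_integral M \<mu> A g =
     (LINT x:A|positive_part_measure M \<mu>. g x) -
     (LINT x:A|positive_part_measure M (\<lambda>B. - \<mu> B). g x)"

subsection \<open>The Stieltjes measure\<close>

abbreviation borel_interval :: "real \<Rightarrow> real measure" where
  "borel_interval S \<equiv> restrict_space borel {0..S}"

text \<open>The value \<open>0\<close> on non-measurable sets is a normalization, needed for uniqueness.\<close>

definition is_stieltjes_measure :: "real \<Rightarrow> (real \<Rightarrow> real) \<Rightarrow> (real set \<Rightarrow> real) \<Rightarrow> bool" where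
  "is_stieltjes_measure S u \<mu> \<longleftrightarrow>
     signed_measure (borel_interval S) \<mu> \<and>
     (\<forall>A. A \<notin> sets (borel_interval S) \<longrightarrow> \<mu> A = 0) \<and>
     (\<forall>s1 s2. 0 \<le> s1 \<and> s1 \<le> s2 \<and> s2 \<le> S \<longrightarrow>
        \<mu> {s1..s2} = right_limit S u s2 - left_limit u s1)"

definition stieltjes_measure :: "real \<Rightarrow> (real \<Rightarrow> real) \<Rightarrow> real set \<Rightarrow> real" where
  "stieltjes_measure S u = (THE \<mu>. is_stieltjes_measure S u \<mu>)"

lemma is_stieltjes_measure_unique:
  assumes "0 \<le> S" and \<mu>: "is_stieltjes_measure S u \<mu>" and \<nu>: "is_stieltjes_measure S u \<nu>"
  shows "\<mu> = \<nu>"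
proof
  fix A
  let ?M = "borel_interval S" and ?X = "{0..S}"
  have inM: "B \<inter> ?X \<in> sets ?M" if "B \<in> sets borel" for B
    using that by (auto simp: sets_restrict_space)
  have diff: "\<rho> ((- B) \<inter> ?X) = \<rho> ?X - \<rho> (B \<inter> ?X)"
    if \<rho>: "signed_measure ?M \<rho>" and B: "B \<in> sets borel" for \<rho> B
  proof -
    let ?B = "\<lambda>i::nat. if i = 0 then B \<inter> ?X else if i = 1 then (- B) \<inter> ?X else {}"
    have "- B \<in> sets borel" using B by auto
    then have "range ?B \<subseteq> sets ?M" using inM B by (auto simp: image_subset_iff)
    moreover have "disjoint_family ?B" by (auto simp: disjoint_family_on_def)
    ultimately have "(\<lambda>i. \<rho> (?B i)) sums \<rho> (\<Union>i. ?B i)"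
      using \<rho> unfolding signed_measure_def by blast
    moreover have "(\<Union>i. ?B i) = ?X"
    proof
      show "?X \<subseteq> (\<Union>i. ?B i)"
      proof
        fix x assume "x \<in> ?X"
        then have "x \<in> ?B 0 \<or> x \<in> ?B 1" by simp
        then show "x \<in> (\<Union>i. ?B i)" by blast
      qed
    qed (auto split: if_splits)
    moreover have "(\<lambda>i. \<rho> (?B i)) sums (\<Sum>i\<in>{0,1}. \<rho> (?B i))"
      using \<rho> by (intro sums_finite) (auto simp: signed_measure_def)
    ultimately have "\<rho> ?X = (\<Sum>i\<in>{0,1}. \<rho> (?B i))" using sums_unique2 by fastforce
    then show ?thesis by simp
  qed
  have sm: "signed_measure ?M \<mu>" "signed_measure ?M \<nu>"
    using \<mu> \<nu> by (auto simp: is_stieltjes_measure_def)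
  have top: "\<mu> ?X = \<nu> ?X" using \<mu> \<nu> \<open>0 \<le> S\<close> by (simp add: is_stieltjes_measure_def)
  have eq: "\<mu> (B \<inter> ?X) = \<nu> (B \<inter> ?X)" if "B \<in> sets borel" for B
    using that
  proof (induction rule: borel_set_induct)
    case empty
    show ?case using sm by (simp add: signed_measure_def)
  next
    case (interval a b)
    show ?case
    proof (cases "max a 0 \<le> min b S")
      case True
      then show ?thesis using \<mu> \<nu> by (simp add: is_stieltjes_measure_def Int_atLeastAtMost)
    next
      case False
      then have "{a..b} \<inter> ?X = {}" by auto
      then show ?thesis using sm by (simp add: signed_measure_def)
    qed
  next
    case (compl B)
    then show ?case using diff[OF sm(1), of B] diff[OF sm(2), of B] top by linarith
  next
    case (union B)
    have "(\<Union>i. B i) \<inter> ?X = (\<Union>i. B i \<inter> ?X)" by blast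
    moreover have "range (\<lambda>i. B i \<inter> ?X) \<subseteq> sets ?M" using inM union by blast
    moreover have "disjoint_family (\<lambda>i. B i \<inter> ?X)"
      using union(1) by (auto simp: disjoint_family_on_def)
    ultimately have "(\<lambda>i. \<rho> (B i \<inter> ?X)) sums \<rho> ((\<Union>i. B i) \<inter> ?X)" if "signed_measure ?M \<rho>" for \<rho>
      using that unfolding signed_measure_def by metis
    from this[OF sm(1)] this[OF sm(2)] show ?case using union(3) by (metis (no_types, lifting) sums_cong sums_unique2)
  qed
  show "\<mu> A = \<nu> A"
  proof (cases "A \<in> sets ?M")
    case True
    then obtain B where "B \<in> sets borel" "A = B \<inter> ?X" by (auto simp: sets_restrict_space)
    then show ?thesis using eq by simp
  qed (use \<mu> \<nu> in \<open>simp add: is_stieltjes_measure_def\<close>)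
qed

lemma stieltjes_measure_eqI:
  "0 \<le> S \<Longrightarrow> is_stieltjes_measure S u \<mu> \<Longrightarrow> stieltjes_measure S u = \<mu>"
  unfolding stieltjes_measure_def by (blast intro: is_stieltjes_measure_unique)

subsection \<open>The discrete quasi-static problem\<close>

definition positive_definite :: "real^'n^'n \<Rightarrow> bool" where
  "positive_definite K \<longleftrightarrow> (\<forall>x. x \<noteq> 0 \<longrightarrow> 0 < x \<bullet> (K *v x))"

definition admissible :: "real^2^2 \<Rightarrow> real \<Rightarrow> real^2 \<Rightarrow> real^2 \<Rightarrow> bool" where
  "admissible K f F u0 \<longleftrightarrow>
     (\<exists>t. K *v u0 = F + t \<and> u0 $ 1 \<le> 0 \<and> t $ 1 \<le> 0 \<and> u0 $ 1 * t $ 1 = 0 \<and>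
        \<bar>t $ 2\<bar> \<le> - f * t $ 1)"

text \<open>The last conjunct of the solution predicate is the equality
  \<open>t\<^sub>t du\<^sub>t = f t\<^sub>n |du\<^sub>t|\<close> of measures: both sides agree on every Borel subset of the interval.\<close>

definition quasistatic_solution ::
    "real^2^2 \<Rightarrow> real \<Rightarrow> real \<Rightarrow> (real \<Rightarrow> real^2) \<Rightarrow> real^2 \<Rightarrow> (real \<Rightarrow> real^2) \<Rightarrow> (real \<Rightarrow> real^2) \<Rightarrow> bool"
  where
  "quasistatic_solution K f S F u0 u t \<longleftrightarrow>
     F \<in> BV_plus S \<and> admissible K f (F 0) u0 \<and>
     u \<in> BV_plus S \<and> t \<in> BV_plus S \<and>
     u 0 = u0 \<and>
     (\<forall>s\<in>{0..S}. K *v u s = F s + t s \<and>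
        u s $ 1 \<le> 0 \<and> t s $ 1 \<le> 0 \<and> u s $ 1 * t s $ 1 = 0 \<and>
        \<bar>t s $ 2\<bar> \<le> - f * t s $ 1) \<and>
     (let M = borel_interval S; du = stieltjes_measure S (\<lambda>s. u s $ 2) in
        \<forall>A\<in>sets M. signed_set_integral M du A (\<lambda>s. t s $ 2) =
          (LINT s:A|total_variation_measure M du. f * t s $ 1))"

end

theory Submission
  imports Defs "HOL-Probability.Giry_Monad"
begin

text \<open>The tangential displacement vanishes before time \<open>1\<close> and is affine afterwards, so its
  Stieltjes measure is a multiple of a Dirac mass at \<open>1\<close> plus a multiple of Lebesgue measure on the
  interval from \<open>1\<close> to \<open>2\<close>.  It therefore charges no subset of the interval before time \<open>1\<close>, while the
  reaction \<open>t\<close> vanishes from time \<open>1\<close> on, so both sides of the friction law are zero.  Positive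
  definiteness and \<open>f \<ge> ktt / knt\<close> give \<open>knn > knt / f\<close>, which makes the jump of \<open>u\<close> at time \<open>1\<close>
  nonzero.\<close>

subsection \<open>Bounded variation of piecewise Lipschitz functions\<close>

text \<open>The hypothesis forces \<open>h\<close> to be nondecreasing, and its increments telescope
  along any partition. Jumps are accommodated by letting \<open>h\<close> have steps.\<close>

lemma bounded_variation_on_dominated:
  fixes u :: "real \<Rightarrow> 'a::metric_space" and h :: "real \<Rightarrow> real"
  assumes dom: "\<And>x y. a \<le> x \<Longrightarrow> x \<le> y \<Longrightarrow> y \<le> b \<Longrightarrow> dist (u x) (u y) \<le> h y - h x"
  shows "bounded_variation_on a b u"
  unfolding bounded_variation_on_def
proof (intro exI allI impI)
  fix n :: nat and p :: "nat \<Rightarrow> real"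
  assume p: "(\<forall>i\<le>n. p i \<in> {a..b}) \<and> (\<forall>i<n. p i \<le> p (Suc i))"
  have mono: "h x \<le> h y" if "a \<le> x" "x \<le> y" "y \<le> b" for x y
    using dom[OF that] zero_le_dist[of "u x" "u y"] by linarith
  have "(\<Sum>i<n. dist (u (p i)) (u (p (Suc i)))) \<le> (\<Sum>i<n. h (p (Suc i)) - h (p i))"
    using p by (intro sum_mono dom) auto
  also have "\<dots> = h (p n) - h (p 0)"
    by (rule sum_lessThan_telescope)
  also have "\<dots> \<le> h b - h a"
  proof -
    have "p n \<in> {a..b}" "p 0 \<in> {a..b}" using p by auto
    then show ?thesis using mono[of "p n" b] mono[of a "p 0"] by auto
  qed
  finally show "(\<Sum>i<n. dist (u (p i)) (u (p (Suc i)))) \<le> h b - h a" .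
qed

lemma BV_plus_piecewise_lipschitz:
  fixes u :: "real \<Rightarrow> 'a::metric_space"
  assumes c: "0 < c" "c \<le> S"
    and l1: "L-lipschitz_on {0..<c} u" and l2: "M-lipschitz_on {c..S} u"
  shows "u \<in> BV_plus S"
proof -
  define N where "N = max L M"
  have N: "N-lipschitz_on {0..<c} u" "N-lipschitz_on {c..S} u"
    using l1 l2 by (auto simp: N_def intro: lipschitz_on_le)
  have N0: "0 \<le> N" using N(1) lipschitz_on_nonneg by blast
  \<comment> \<open>The dominating function is linear with a step of height \<open>D\<close> at
    \<open>c\<close>. Since no left limit at \<open>c\<close> need exist in an incomplete space, the
    step is measured from the base point 0, and \<open>N * S\<close> pays for the way from
    \<open>x\<close> back to 0.\<close>
  define D where "D = dist (u 0) (u c) + N * S"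
  define h where "h x = N * x + (if x < c then 0 else D)" for x
  have "dist (u x) (u y) \<le> h y - h x" if xy: "0 \<le> x" "x \<le> y" "y \<le> S" for x y
  proof -
    consider "y < c" | "c \<le> x" | "x < c" "c \<le> y" by linarith
    then show ?thesis
    proof cases
      case 1
      then show ?thesis using lipschitz_onD[OF N(1), of x y] xy
        by (simp add: h_def dist_real_def algebra_simps)
    next
      case 2
      then show ?thesis using lipschitz_onD[OF N(2), of x y] xy
        by (simp add: h_def dist_real_def algebra_simps)
    next
      case 3
      have "dist (u x) (u y) \<le> dist (u x) (u 0) + dist (u 0) (u c) + dist (u c) (u y)"
        using dist_triangle[of "u x" "u y" "u 0"] dist_triangle[of "u 0" "u y" "u c"] by linarith
      also have "\<dots> \<le> N * x + dist (u 0) (u c) + N * (y - c)"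
        using lipschitz_onD[OF N(1), of x 0] lipschitz_onD[OF N(2), of c y] xy 3 c
        by (simp add: dist_real_def)
      also have "\<dots> \<le> N * (y - x) + D"
      proof -
        have "N * (x + (y - c)) \<le> N * (S + (y - x))"
          using xy 3 N0 by (intro mult_left_mono) auto
        then show ?thesis by (simp add: D_def algebra_simps)
      qed
      finally show ?thesis using 3 by (simp add: h_def algebra_simps)
    qed
  qed
  then have "bounded_variation_on 0 S u" by (rule bounded_variation_on_dominated)
  moreover have "continuous (at_right s) u" if "s \<in> {0..<S}" for s
  proof (cases "s < c")
    case True
    have "continuous (at s within {0..<c}) u"
      using lipschitz_on_continuous_on[OF l1] True that by (simp add: continuous_on_eq_continuous_within)
    \<comment> \<open>The midpoint keeps this closed interval inside the first piece; any closed
      interval starting at \<open>s\<close> yields the right-hand filter.\<close>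
    then have "continuous (at s within {s..(s + c) / 2}) u"
      using True that by (elim continuous_within_subset) auto
    then show ?thesis using True by (simp add: at_within_Icc_at_right)
  next
    case False
    have "continuous (at s within {c..S}) u"
      using lipschitz_on_continuous_on[OF l2] False that by (simp add: continuous_on_eq_continuous_within)
    then have "continuous (at s within {s..S}) u"
      using False that by (elim continuous_within_subset) auto
    then show ?thesis using that by (simp add: at_within_Icc_at_right)
  qed
  ultimately show ?thesis by (simp add: BV_plus_def)
qed

lemma lipschitz_on_affine:
  fixes u :: "real \<Rightarrow> 'a::real_normed_vector"
  assumes "\<And>s. s \<in> X \<Longrightarrow> u s = p + s *\<^sub>R q"
  shows "(norm q)-lipschitz_on X u"
proof (rule lipschitz_onI)
  fix x y assume "x \<in> X" "y \<in> X"
  then have "u x - u y = (x - y) *\<^sub>R q" using assms by (simp add: algebra_simps)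
  then show "dist (u x) (u y) \<le> norm q * dist x y" by (simp add: dist_norm mult.commute)
qed simp

subsection \<open>The Stieltjes measure of a jump followed by an affine function\<close>

text \<open>The candidate for a function that jumps by \<open>a\<close> at \<open>c\<close> and then
  has slope \<open>b\<close>. The default 0 is the normalization required by
  \<open>is_stieltjes_measure\<close>.\<close>

definition jump_affine_measure :: "real \<Rightarrow> real \<Rightarrow> real \<Rightarrow> real \<Rightarrow> real set \<Rightarrow> real" where
  "jump_affine_measure S c a b A =
     (if A \<in> sets (borel_interval S)
      then a * measure (return borel c) A + b * measure lborel (A \<inter> {c..S}) else 0)"

lemma sets_borel_interval: "sets (borel_interval S) = {A \<in> sets borel. A \<subseteq> {0..S}}"
  by (auto simp: sets_restrict_space)

lemma signed_measure_jump_affine: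
  "signed_measure (borel_interval S) (jump_affine_measure S c a b)"
  unfolding signed_measure_def
proof (intro conjI allI impI)
  show "jump_affine_measure S c a b {} = 0" by (simp add: jump_affine_measure_def)
next
  fix A :: "nat \<Rightarrow> real set"
  assume A: "range A \<subseteq> sets (borel_interval S)" "disjoint_family A"
  have Ab: "A i \<in> sets borel" for i using A(1) by (auto simp: sets_borel_interval)
  have U: "(\<Union>i. A i) \<in> sets (borel_interval S)"
    using A(1) by (intro sets.countable_UN) auto
  have "(\<lambda>i. measure (return borel c) (A i)) sums measure (return borel c) (\<Union>i. A i)"
    using A Ab by (intro measure_UNION) (auto simp: emeasure_return indicator_def)
  moreover have "(\<lambda>i. measure lborel (A i \<inter> {c..S})) sums measure lborel (\<Union>i. A i \<inter> {c..S})"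
  proof (rule measure_UNION)
    \<comment> \<open>Additivity of the real-valued \<open>measure\<close> requires finite mass,
      which boundedness provides.\<close>
    have "(\<Union>i. A i \<inter> {c..S}) \<subseteq> {c..S}" by auto
    from emeasure_mono[OF this, of lborel]
    have "emeasure lborel (\<Union>i. A i \<inter> {c..S}) < \<infinity>"
      using emeasure_lborel_cbox_finite[of c S] by (auto intro: le_less_trans)
    then show "emeasure lborel (\<Union>i. A i \<inter> {c..S}) \<noteq> \<infinity>" by simp
  qed (use A Ab in \<open>auto simp: disjoint_family_on_def\<close>)
  moreover have "(\<Union>i. A i \<inter> {c..S}) = (\<Union>i. A i) \<inter> {c..S}" by blast
  ultimately have "(\<lambda>i. a * measure (return borel c) (A i) + b * measure lborel (A i \<inter> {c..S})) sums
      (a * measure (return borel c) (\<Union>i. A i) + b * measure lborel ((\<Union>i. A i) \<inter> {c..S}))"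
    by (auto intro!: sums_add sums_mult)
  moreover have "A i \<in> sets (borel_interval S)" for i using A(1) by blast
  ultimately show "(\<lambda>i. jump_affine_measure S c a b (A i)) sums jump_affine_measure S c a b (\<Union>i. A i)"
    using U by (simp add: jump_affine_measure_def)
qed

text \<open>Both the atom and the Lebesgue part live on times from \<open>c\<close> on; non-Borel
  sets get 0 by default.\<close>

lemma jump_affine_measure_eq_0:
  assumes "B \<subseteq> {..<c}"
  shows "jump_affine_measure S c a b B = 0"
proof -
  have "B \<inter> {c..S} = {}" "c \<notin> B" using assms by auto
  then show ?thesis by (auto simp: jump_affine_measure_def measure_return sets_borel_interval)
qed

lemma is_stieltjes_measure_jump_affine:
  assumes c: "0 < c" "c \<le> S"
    and g1: "\<And>s. s \<in> {0..<c} \<Longrightarrow> g s = 0"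
    and g2: "\<And>s. s \<in> {c..S} \<Longrightarrow> g s = a + b * (s - c)"
  shows "is_stieltjes_measure S g (jump_affine_measure S c a b)"
proof -
  \<comment> \<open>At \<open>s = c\<close> the left limit is still 0 while the right limit is
    already \<open>a\<close>: hence \<open>s \<le> c\<close> here and \<open>s < c\<close> below.
    The difference is the mass of the atom.\<close>
  have left: "left_limit g s = (if s \<le> c then 0 else a + b * (s - c))" if s: "0 \<le> s" "s \<le> S" for s
  proof (cases "s = 0")
    case True
    then show ?thesis using g1[of 0] c by (simp add: left_limit_def)
  next
    case False
    have "(g \<longlongrightarrow> (if s \<le> c then 0 else a + b * (s - c))) (at_left s)"
    proof (cases "s \<le> c")
      case True
      have "\<forall>\<^sub>F x in at_left s. 0 = g x"
        unfolding eventually_at_left_field using s True False g1 by (intro exI[of _ 0]) auto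
      then show ?thesis using True by (auto intro: Lim_transform_eventually tendsto_const)
    next
      case sc: False
      have "((\<lambda>x. a + b * (x - c)) \<longlongrightarrow> a + b * (s - c)) (at_left s)"
        by (intro tendsto_intros)
      moreover have "\<forall>\<^sub>F x in at_left s. a + b * (x - c) = g x"
        unfolding eventually_at_left_field using s sc g2 by (intro exI[of _ c]) auto
      ultimately show ?thesis using sc by (auto intro: Lim_transform_eventually)
    qed
    then have "Lim (at_left s) g = (if s \<le> c then 0 else a + b * (s - c))"
      by (intro tendsto_Lim) auto
    then show ?thesis using False by (simp add: left_limit_def)
  qed
  have right: "right_limit S g s = (if s < c then 0 else a + b * (s - c))" if s: "0 \<le> s" "s \<le> S" for s
  proof (cases "s = S")
    case True
    then show ?thesis using g2[of S] c by (simp add: right_limit_def)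
  next
    case False
    have "(g \<longlongrightarrow> (if s < c then 0 else a + b * (s - c))) (at_right s)"
    proof (cases "s < c")
      case True
      have "\<forall>\<^sub>F x in at_right s. 0 = g x"
        unfolding eventually_at_right_field using s True g1 by (intro exI[of _ c]) auto
      then show ?thesis using True by (auto intro: Lim_transform_eventually tendsto_const)
    next
      case sc: False
      have "((\<lambda>x. a + b * (x - c)) \<longlongrightarrow> a + b * (s - c)) (at_right s)"
        by (intro tendsto_intros)
      moreover have "\<forall>\<^sub>F x in at_right s. a + b * (x - c) = g x"
        unfolding eventually_at_right_field using s sc False g2 by (intro exI[of _ S]) auto
      ultimately show ?thesis using sc by (auto intro: Lim_transform_eventually)
    qed
    then have "Lim (at_right s) g = (if s < c then 0 else a + b * (s - c))"
      by (intro tendsto_Lim) auto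
    then show ?thesis using False by (simp add: right_limit_def)
  qed
  have "jump_affine_measure S c a b {s1..s2} = right_limit S g s2 - left_limit g s1"
    if s: "0 \<le> s1" "s1 \<le> s2" "s2 \<le> S" for s1 s2
  proof -
    have "{s1..s2} \<in> sets (borel_interval S)" using s by (auto simp: sets_borel_interval)
    moreover have "{s1..s2} \<inter> {c..S} = {max s1 c..s2}" using s by auto
    ultimately have "jump_affine_measure S c a b {s1..s2} =
        a * indicator {s1..s2} c + b * measure lborel {max s1 c..s2}"
      by (simp add: jump_affine_measure_def measure_return del: Int_atLeastAtMost)
    then show ?thesis using s left[of s1] right[of s2]
      by (auto simp: indicator_def max_def algebra_simps)
  qed
  then show ?thesis
    using signed_measure_jump_affine
    by (auto simp: is_stieltjes_measure_def jump_affine_measure_def)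
qed

subsection \<open>Sets charged neither by the variation nor by the positive part\<close>

text \<open>Countable additivity of \<open>\<mu>\<close> is not needed: if it fails, \<^const>\<open>measure_of\<close> yields the zero
  measure.  Hence the Hahn decomposition is avoided.\<close>

lemma null_sets_measure_of:
  assumes "N \<in> sets M" "\<mu> N = 0"
  shows "N \<in> null_sets (measure_of (space M) (sets M) \<mu>)"
  using assms by (auto simp: null_sets_def emeasure_measure_of_conv sets.sigma_sets_eq sets.space_closed)

text \<open>Every block of a partition of \<open>N\<close> lies in \<open>N\<close>, so all sums
  under the supremum are 0.\<close>

lemma null_sets_total_variation:
  assumes N: "N \<in> sets M" and \<mu>: "\<And>B. B \<subseteq> N \<Longrightarrow> \<mu> B = 0"
  shows "N \<in> null_sets (total_variation_measure M \<mu>)"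
  unfolding total_variation_measure_def
proof (rule null_sets_measure_of[OF N])
  have "(\<Sum>B\<in>P. ennreal \<bar>\<mu> B\<bar>) = 0" if "\<Union>P = N" for P
    using that by (intro sum.neutral) (auto simp: \<mu> Sup_upper)
  then show "(SUP P\<in>{P. finite P \<and> P \<subseteq> sets M \<and> disjoint P \<and> \<Union>P = N}.
      \<Sum>B\<in>P. ennreal \<bar>\<mu> B\<bar>) = 0"
    by (intro antisym SUP_least) auto
qed

text \<open>Applied to both \<open>\<mu>\<close> and its negative, this covers the two halves of the
  Jordan decomposition.\<close>

lemma null_sets_positive_part:
  assumes N: "N \<in> sets M" and \<mu>: "\<And>B. B \<subseteq> N \<Longrightarrow> \<mu> B = 0"
  shows "N \<in> null_sets (positive_part_measure M \<mu>)"
  unfolding positive_part_measure_def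
proof (rule null_sets_measure_of[OF N])
  show "(SUP B\<in>{B \<in> sets M. B \<subseteq> N}. ennreal (\<mu> B)) = 0"
    by (intro antisym SUP_least) (auto simp: \<mu>)
qed

lemma set_integral_eq_0_outside_null:
  fixes g :: "'a \<Rightarrow> real"
  assumes "N \<in> null_sets M" and "\<And>x. x \<in> space M - N \<Longrightarrow> g x = 0"
  shows "(LINT x:A|M. g x) = 0"
proof -
  have "AE x in M. indicator A x *\<^sub>R g x = 0"
    by (rule AE_I'[OF assms(1)]) (use assms(2) in auto)
  then show ?thesis unfolding set_lebesgue_integral_def by (rule integral_eq_zero_AE)
qed

lemma space_total_variation_measure [simp]: "space (total_variation_measure M \<mu>) = space M"
  by (simp add: total_variation_measure_def sets.space_closed space_measure_of)

lemma space_positive_part_measure [simp]: "space (positive_part_measure M \<mu>) = space M"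
  by (simp add: positive_part_measure_def sets.space_closed space_measure_of)

lemma has_jump_atI:
  assumes "(u \<longlongrightarrow> l) (at_left s)" and "continuous (at_right s) u" and "l \<noteq> u s"
  shows "has_jump_at u s"
  using assms by (auto simp: has_jump_at_def continuous_within)

subsection \<open>The jump solution\<close>

lemma positive_definite_2:
  assumes "positive_definite (vector [vector [p, q], vector [q, r]] :: real^2^2)"
  shows "0 < p" "0 < r" "0 < p * r - q\<^sup>2"
proof -
  let ?K = "vector [vector [p, q], vector [q, r]] :: real^2^2"
  have quad: "0 < x * (p * x + q * y) + y * (q * x + r * y)" if "x \<noteq> 0 \<or> y \<noteq> 0" for x y
  proof -
    have "(vector [x, y] :: real^2) \<noteq> 0"
      using that by (auto simp: vec_eq_iff forall_2)
    then have "0 < (vector [x, y] :: real^2) \<bullet> (?K *v vector [x, y])"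
      using assms unfolding positive_definite_def by blast
    then show ?thesis
      by (simp add: inner_vec_def matrix_vector_mult_def sum_2)
  qed
  show p: "0 < p" using quad[of 1 0] by simp
  show "0 < r" using quad[of 0 1] by simp
  \<comment> \<open>The test vector \<open>(-q, p)\<close> is orthogonal to the first row, so only
    the second row contributes, giving \<open>p\<close> times the determinant.\<close>
  have "0 < p * (p * r - q\<^sup>2)"
    using quad[of "- q" p] p by (simp add: power2_eq_square algebra_simps)
  then show "0 < p * r - q\<^sup>2" using p by (simp add: zero_less_mult_iff)
qed

theorem proposition3p5:
  fixes knn knt ktt f R :: real
    and K :: "real^2^2"
    and F u t :: "real \<Rightarrow> real^2"
  assumes K: "K = vector [vector [knn, knt], vector [knt, ktt]]"
    and pd: "positive_definite K"
    and knt: "knt > 0"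
    and f_nonneg: "f \<ge> 0"
    and f: "f \<ge> ktt / knt"
    and R: "R > 0"
    and F1: "\<And>s. s \<in> {0..1} \<Longrightarrow> F s = vector [s * R / f, s * R]"
    and F2: "\<And>s. s \<in> {1..2} \<Longrightarrow> F s = vector [R / f + (s - 1), R + (f + 1) * (s - 1)]"
    and u1: "\<And>s. s \<in> {0..<1} \<Longrightarrow> u s = 0"
    and t1: "\<And>s. s \<in> {0..<1} \<Longrightarrow> t s = - F s"
    and t2: "\<And>s. s \<in> {1..2} \<Longrightarrow> t s = 0"
    and u2: "\<And>s. s \<in> {1..2} \<Longrightarrow> u s =
      vector [(R * (ktt / f - knt) + (ktt - knt * (f + 1)) * (s - 1)) / (knn * ktt - knt\<^sup>2),
              (R * (knn - knt / f) + (knn * (f + 1) - knt) * (s - 1)) / (knn * ktt - knt\<^sup>2)]"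
  shows "(\<exists>L. L-lipschitz_on {0..2} F) \<and>
    (\<forall>s\<in>{1..2}. u s $ 1 \<le> 0) \<and>
    quasistatic_solution K f 2 F 0 u t \<and>
    has_jump_at u 1 \<and> has_jump_at t 1"
proof -
  define D where "D = knn * ktt - knt\<^sup>2"
  have D: "0 < D" and knn: "0 < knn" and ktt: "0 < ktt"
    using positive_definite_2 pd unfolding K D_def by blast+
  have f0: "0 < f" using f ktt knt divide_pos_pos[of ktt knt] by linarith
  have fk: "ktt \<le> f * knt" using f knt by (simp add: field_simps)

  \<comment> \<open>Lipschitz bounds and bounded variation\<close>
  have FL1: "(norm (vector [R / f, R] :: real^2))-lipschitz_on {0..1} F"
    by (rule lipschitz_on_affine[where p = 0])
      (simp add: F1 vec_eq_iff forall_2)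
  have FL2: "(norm (vector [1, f + 1] :: real^2))-lipschitz_on {1..2} F"
    by (rule lipschitz_on_affine[where p = "vector [R / f - 1, R - (f + 1)]"])
      (simp add: F2 vec_eq_iff forall_2 algebra_simps)
  \<comment> \<open>The concatenation rule glues two functions that agree at 1; both are
    \<open>F\<close>, so the conditional collapses.\<close>
  have "(max (norm (vector [R / f, R] :: real^2)) (norm (vector [1, f + 1] :: real^2)))-lipschitz_on {0..2}
      (\<lambda>s. if s \<le> 1 then F s else F s)"
    by (rule lipschitz_on_concat_max[OF FL1 FL2 refl])
  then obtain L where FL: "L-lipschitz_on {0..2} F"
    by (auto simp only: if_cancel)
  have tL1: "L-lipschitz_on {0..<1} t"
  proof (rule lipschitz_on_transform)
    show "L-lipschitz_on {0..<1} (\<lambda>s. - F s)"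
      by (intro lipschitz_on_minus lipschitz_on_subset[OF FL]) auto
  qed (simp add: t1)
  have tL2: "0-lipschitz_on {1..2} t"
    by (rule lipschitz_onI) (auto simp: t2)
  have uL1: "0-lipschitz_on {0..<1} u"
    by (rule lipschitz_onI) (auto simp: u1)
  \<comment> \<open>The velocity after the jump; \<open>p\<close> below is \<open>u 1\<close>
    extrapolated back to time 0.\<close>
  define q :: "real^2" where
    "q = vector [(ktt - knt * (f + 1)) / D, (knn * (f + 1) - knt) / D]"
  have uL2: "(norm q)-lipschitz_on {1..2} u"
    by (rule lipschitz_on_affine[where
        p = "vector [R * (ktt / f - knt) / D, R * (knn - knt / f) / D] - q"])
      (simp add: u2 q_def vec_eq_iff forall_2 flip: D_def, simp add: field_simps D[THEN less_imp_neq, symmetric])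
  have FBV: "F \<in> BV_plus 2"
    by (rule BV_plus_piecewise_lipschitz[of 1 _ L _ L])
      (auto intro: lipschitz_on_subset[OF FL])
  have uBV: "u \<in> BV_plus 2"
    by (rule BV_plus_piecewise_lipschitz[OF _ _ uL1 uL2]) auto
  have tBV: "t \<in> BV_plus 2"
    by (rule BV_plus_piecewise_lipschitz[OF _ _ tL1 tL2]) auto

  \<comment> \<open>Contact conditions, equilibrium and friction cone\<close>
  have un: "u s $ 1 \<le> 0" if s: "s \<in> {1..2}" for s
  proof -
    have "ktt / f - knt \<le> 0" using fk f0 by (simp add: field_simps)
    then have "R * (ktt / f - knt) \<le> 0" using R by (simp add: mult_le_0_iff)
    moreover have "ktt - knt * (f + 1) \<le> 0" using fk knt by (simp add: algebra_simps)
    then have "(ktt - knt * (f + 1)) * (s - 1) \<le> 0" using s by (simp add: mult_le_0_iff)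
    ultimately show ?thesis using D u2[OF s] by (simp add: divide_le_0_iff flip: D_def)
  qed

  have balance: "K *v u s = F s + t s \<and> u s $ 1 \<le> 0 \<and> t s $ 1 \<le> 0 \<and>
      u s $ 1 * t s $ 1 = 0 \<and> \<bar>t s $ 2\<bar> \<le> - f * t s $ 1" if s: "s \<in> {0..2}" for s
  proof (cases "s < 1")
    case True
    \<comment> \<open>Here \<open>t = - F\<close> lies on the boundary of the friction cone: the
      last inequality is an equality.\<close>
    then show ?thesis using s u1[of s] t1[of s] F1[of s] R f0 by (simp add: abs_mult)
  next
    case False
    then have s': "s \<in> {1..2}" using s by auto
    \<comment> \<open>Cramer's rule for \<open>K\<close>. After the jump contact is free of
      reaction, and the prescribed \<open>u s\<close> is the inverse of \<open>K\<close> applied to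
      \<open>F s\<close>.\<close>
    have inv: "knn * ((ktt * x - knt * y) / D) + knt * ((knn * y - knt * x) / D) = x"
      "knt * ((ktt * x - knt * y) / D) + ktt * ((knn * y - knt * x) / D) = y" for x y
      using D by (simp_all add: D_def divide_simps) (simp_all add: algebra_simps power2_eq_square)
    have "u s $ 1 = (ktt * F s $ 1 - knt * F s $ 2) / D" "u s $ 2 = (knn * F s $ 2 - knt * F s $ 1) / D"
      using u2[OF s'] F2[OF s'] f0 by (simp_all add: algebra_simps flip: D_def)
    then have "K *v u s = F s"
      using inv[of "F s $ 1" "F s $ 2"]
      by (simp add: K vec_eq_iff forall_2 matrix_vector_mult_def sum_2)
    then show ?thesis using un[OF s'] t2[OF s'] by simp
  qed

  \<comment> \<open>The friction law as an equality of measures\<close>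
  define a where "a = R * (knn - knt / f) / D"
  define b where "b = (knn * (f + 1) - knt) / D"
  have "0 < a"
  proof -
    \<comment> \<open>The determinant bound and the friction threshold combine; cancelling
      \<open>knt\<close> then makes the tangential jump positive.\<close>
    have "knt * knt < knn * ktt" using D by (simp add: D_def power2_eq_square)
    also have "\<dots> \<le> knn * (f * knt)" using fk knn by simp
    finally have "knt < knn * f" using knt by (simp add: mult.assoc[symmetric])
    then show ?thesis using f0 R D by (simp add: a_def field_simps)
  qed
  let ?M = "borel_interval 2"
  let ?du = "stieltjes_measure 2 (\<lambda>s. u s $ 2)"
  have du: "?du = jump_affine_measure 2 1 a b"
    by (intro stieltjes_measure_eqI is_stieltjes_measure_jump_affine)
      (use D in \<open>auto simp: u1 u2 a_def b_def add_divide_distrib simp flip: D_def\<close>)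
  \<comment> \<open>The half-open interval leaves time 1 to the other side: the atom of
    \<open>?du\<close> there meets \<open>t 1 = 0\<close>.\<close>
  have null: "?du B = 0" if "B \<subseteq> {0..<1}" for B
    using that unfolding du by (intro jump_affine_measure_eq_0) auto
  have meas: "{0..<1} \<in> sets ?M" by (auto simp: sets_borel_interval)
  have t_eq_0: "t s $ i = 0" if "s \<in> space ?M - {0..<1}" for s i
    using that t2[of s] by (auto simp: space_restrict_space)
  have "signed_set_integral ?M ?du A (\<lambda>s. t s $ 2) = 0" for A
  proof -
    have "(LINT s:A|positive_part_measure ?M ?du. t s $ 2) = 0"
      by (rule set_integral_eq_0_outside_null[OF null_sets_positive_part[OF meas]])
        (use null t_eq_0 in auto)
    moreover have "(LINT s:A|positive_part_measure ?M (\<lambda>B. - ?du B). t s $ 2) = 0"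
      by (rule set_integral_eq_0_outside_null[OF null_sets_positive_part[OF meas]])
        (use null t_eq_0 in auto)
    ultimately show ?thesis by (simp add: signed_set_integral_def)
  qed
  moreover have "(LINT s:A|total_variation_measure ?M ?du. f * t s $ 1) = 0" for A
    by (rule set_integral_eq_0_outside_null[OF null_sets_total_variation[OF meas]])
      (use null t_eq_0 in auto)
  \<comment> \<open>\<open>F 0\<close> vanishes, so the zero reaction is a witness.\<close>
  moreover have "admissible K f (F 0) 0"
    using F1[of 0] by (auto simp: admissible_def vec_eq_iff forall_2 intro!: exI[of _ 0])
  ultimately have sol: "quasistatic_solution K f 2 F 0 u t"
    using FBV uBV tBV balance u1[of 0] by (simp add: quasistatic_solution_def Let_def)

  \<comment> \<open>The jumps at time 1\<close>
  have before: "\<forall>\<^sub>F x in at_left 1. x \<in> {0..<1::real}"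
    unfolding eventually_at_left_field by (intro exI[of _ 0]) auto
  have "has_jump_at u 1"
  proof (rule has_jump_atI)
    have "\<forall>\<^sub>F x in at_left 1. 0 = u x" using before by eventually_elim (simp add: u1)
    then show "(u \<longlongrightarrow> 0) (at_left 1)" by (rule Lim_transform_eventually[OF tendsto_const])
    \<comment> \<open>The tangential component is the one to compare: the normal one stays 0 at time
      1 when \<open>f = ktt / knt\<close>.\<close>
    have "u 1 $ 2 = a" by (simp add: u2 a_def D_def)
    then show "0 \<noteq> u 1" using \<open>0 < a\<close> by auto
  qed (use uBV in \<open>auto simp: BV_plus_def\<close>)
  moreover have "has_jump_at t 1"
  proof (rule has_jump_atI)
    have "continuous (at 1 within {0..2}) F"
      using lipschitz_on_continuous_on[OF FL] by (simp add: continuous_on_eq_continuous_within)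
    then have "continuous (at 1 within {0..1}) F" by (rule continuous_within_subset) auto
    then have "((\<lambda>x. - F x) \<longlongrightarrow> - F 1) (at_left 1)"
      by (intro tendsto_minus) (simp add: continuous_within at_within_Icc_at_left)
    moreover have "\<forall>\<^sub>F x in at_left 1. - F x = t x" using before by eventually_elim (simp add: t1)
    ultimately show "(t \<longlongrightarrow> - F 1) (at_left 1)" by (rule Lim_transform_eventually)
    show "- F 1 \<noteq> t 1" using R F1[of 1] t2[of 1] by (simp add: vec_eq_iff forall_2)
  qed (use tBV in \<open>auto simp: BV_plus_def\<close>)
  ultimately show ?thesis using FL un sol by blast
qed

end
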